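(* Let $n_o,n_m,p\ge 1$, let $\mathbf{X}_o\in\mathbb{R}^{n_o\times p}$ with $\mathbf{X}_o^T\mathbf{X}_o$ invertible, $\mathbf{X}_m\in\mathbb{R}^{n_m\times p}$ and $\mathbf{Y}_o\in\mathbb{R}^{n_o}$, where missing values occur only in the response variable. Replace the $n_m$ missing responses by zeros and, for each missing value, add a covariate that is $-1$ at that observation and $0$ at all others, so that the design matrix is $$\mathbf{Z}=\begin{pmatrix}\mathbf{X}_o&\mathbf{0}_{n_o\times n_m}\\ \mathbf{X}_m&-\mathbf{I}_{n_m}\end{pmatrix},$$ and let $\mathbf{b}_m\in\mathbb{R}^{n_m}$ consist of the ordinary least squares coefficients of the last $n_m$ columns, i.e. the last $n_m$ entries of $(\mathbf{Z}^T\mathbf{Z})^{-1}\mathbf{Z}^T\begin{pmatrix}\mathbf{Y}_o\\ \mathbf{0}_{n_m}\end{pmatrix}$. Then $\mathbf{b}_m$ equals the vector of point estimates for new observations with covariates $\mathbf{X}_m$, $$\mathbf{b}_m=\mathbf{X}_m(\mathbf{X}_o^T\mathbf{X}_o)^{-1}\mathbf{X}_o^T\mathbf{Y}_o,$$ and as such $\mathbf{b}_m$ furnishes the EM algorithm imputations of the missing responses, as defined in the context.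
   Context: A response variable has $n=n_o+n_m$ entries, of which $n_o$ are observed (vector $\mathbf{Y}_o$) and $n_m$ are missing; $\mathbf{X}_o$ and $\mathbf{X}_m$ are the (fully known) covariate matrices, possibly including an intercept column of ones, for the observations with observed and missing response, respectively. Put $\mathbf{X}=\begin{pmatrix}\mathbf{X}_o\\ \mathbf{X}_m\end{pmatrix}$. The EM algorithm iterates: given coefficients $\mathbf{b}^{(\tau)}\in\mathbb{R}^p$, impute the missing responses by $\mathbf{X}_m\mathbf{b}^{(\tau)}$, then let $\mathbf{b}^{(\tau+1)}$ be the ordinary least squares coefficients of the completed response on $\mathbf{X}$. The EM algorithm imputations are the entries of $\mathbf{X}_m\mathbf{b}$, where $\mathbf{b}$ is the vector converged upon, which satisfies $$\mathbf{b}=(\mathbf{X}^T\mathbf{X})^{-1}\mathbf{X}^T\begin{pmatrix}\mathbf{Y}_o\\ \mathbf{X}_m\mathbf{b}\end{pmatrix}.$$ That the iteration converges is presupposed, not part of the claim. *)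

theory Defs
  imports "HOL-Analysis.Analysis"
begin

text \<open>Observations are indexed by \<open>'no + 'nm\<close> (observed, then missing), the columns of the
  augmented design matrix by \<open>'p + 'nm\<close>. Index types are nonempty, so all dimensions are
  at least 1.\<close>

text \<open>A matrix of type \<open>real ^ 'p ^ 'n\<close> is the vector of its rows, so \<open>vstack\<close>
  stacks matrices as well as column vectors.\<close>

definition vstack :: "'a ^ 'm \<Rightarrow> 'a ^ 'n \<Rightarrow> 'a ^ ('m + 'n)" where
  "vstack u v = (\<chi> i. case i of Inl a \<Rightarrow> u $ a | Inr b \<Rightarrow> v $ b)"

definition hstack :: "'a ^ 'p ^ 'm \<Rightarrow> 'a ^ 'q ^ 'm \<Rightarrow> 'a ^ ('p + 'q) ^ 'm" where
  "hstack A B = (\<chi> i. vstack (A $ i) (B $ i))"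

definition vlower :: "'a ^ ('m::finite + 'n::finite) \<Rightarrow> 'a ^ 'n" where
  "vlower v = (\<chi> j. v $ Inr j)"

text \<open>Meaningful only if \<open>transpose X ** X\<close> is invertible; otherwise \<open>matrix_inv\<close> is unspecified.\<close>

definition ols :: "real ^ 'p ^ 'n \<Rightarrow> real ^ 'n \<Rightarrow> real ^ 'p" where
  "ols X y = (matrix_inv (transpose X ** X) ** transpose X) *v y"

definition augmented_design ::
  "real ^ 'p ^ 'no \<Rightarrow> real ^ 'p ^ 'nm \<Rightarrow> real ^ ('p + 'nm) ^ ('no + 'nm)" where
  "augmented_design Xo Xm = vstack (hstack Xo 0) (hstack Xm (- mat 1))"

definition em_step ::
  "real ^ 'p ^ 'no \<Rightarrow> real ^ 'p ^ 'nm \<Rightarrow> real ^ 'no \<Rightarrow> real ^ 'p \<Rightarrow> real ^ 'p" where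
  "em_step Xo Xm Yo b = ols (vstack Xo Xm) (vstack Yo (Xm *v b))"

definition em_converges_to ::
  "real ^ 'p ^ 'no \<Rightarrow> real ^ 'p ^ 'nm \<Rightarrow> real ^ 'no \<Rightarrow> real ^ 'p \<Rightarrow> real ^ 'p \<Rightarrow> bool" where
  "em_converges_to Xo Xm Yo b0 b \<longleftrightarrow> (\<lambda>\<tau>. (em_step Xo Xm Yo ^^ \<tau>) b0) \<longlonglongrightarrow> b"

lemma isCont_em_step: "isCont (em_step Xo Xm Yo) b"
proof -
  have 1: "continuous_on UNIV (\<lambda>b. vstack Yo (Xm *v b))"
    unfolding vstack_def
  proof (rule continuous_on_vec_lambda)
    fix i
    show "continuous_on UNIV (\<lambda>b. case i of Inl a \<Rightarrow> Yo $ a | Inr c \<Rightarrow> (Xm *v b) $ c)"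
      by (cases i) (auto simp: matrix_vector_mult_def intro!: continuous_intros)
  qed
  have "continuous_on UNIV (em_step Xo Xm Yo)"
    unfolding em_step_def ols_def
    by (rule continuous_on_compose2[OF matrix_vector_mult_linear_continuous_on 1]) auto
  then show ?thesis
    by (simp add: continuous_on_eq_continuous_at)
qed

text \<open>The vectors the iteration can converge to are exactly the solutions of the fixed-point
  equation.\<close>

lemma em_limit_iff_fixed_point:
  "(\<exists>b0. em_converges_to Xo Xm Yo b0 b) \<longleftrightarrow>
    b = ols (vstack Xo Xm) (vstack Yo (Xm *v b))"
proof
  assume "\<exists>b0. em_converges_to Xo Xm Yo b0 b"
  then obtain b0 where lim: "(\<lambda>\<tau>. (em_step Xo Xm Yo ^^ \<tau>) b0) \<longlonglongrightarrow> b"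
    by (auto simp: em_converges_to_def)
  have "(\<lambda>\<tau>. em_step Xo Xm Yo ((em_step Xo Xm Yo ^^ \<tau>) b0)) \<longlonglongrightarrow> em_step Xo Xm Yo b"
    using isCont_em_step lim by (rule isCont_tendsto_compose)
  moreover have "(\<lambda>\<tau>. em_step Xo Xm Yo ((em_step Xo Xm Yo ^^ \<tau>) b0)) \<longlonglongrightarrow> b"
    using LIMSEQ_Suc[OF lim] by simp
  ultimately have "em_step Xo Xm Yo b = b"
    by (rule LIMSEQ_unique)
  then show "b = ols (vstack Xo Xm) (vstack Yo (Xm *v b))"
    by (simp add: em_step_def)
next
  assume "b = ols (vstack Xo Xm) (vstack Yo (Xm *v b))"
  then have fixed: "em_step Xo Xm Yo b = b"
    by (simp add: em_step_def)
  have "(em_step Xo Xm Yo ^^ \<tau>) b = b" for \<tau>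
    by (induction \<tau>) (simp_all add: fixed)
  then show "\<exists>b0. em_converges_to Xo Xm Yo b0 b"
    unfolding em_converges_to_def by (intro exI[of _ b]) simp
qed

end

theory Submission
  imports Defs
begin

text \<open>Least squares coefficients are the solutions of the normal equations. Completing
  \<open>ols Xo Yo\<close> by its own predictions \<open>Xm *v ols Xo Yo\<close> makes the augmented model fit the
  zero responses exactly, and the remaining residual is orthogonal to the columns of \<open>Xo\<close>, so
  the normal equations of the augmented model hold. At an EM fixed point the contribution of the
  imputed rows cancels from both sides of the normal equations, which leaves those of the
  observed rows.\<close>

text \<open>As a simp rule it would turn \<open>transpose A *v x\<close> into \<open>x v* A\<close>
  and hide the form on which the block rules for transposes act.\<close>

declare transpose_matrix_vector [simp del]

lemma vstack_Inl [simp]: "vstack u v $ Inl i = u $ i"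
  and vstack_Inr [simp]: "vstack u v $ Inr j = v $ j"
  by (simp_all add: vstack_def)

lemma vstack_cases:
  fixes w :: "'a ^ ('m::finite + 'n::finite)"
  obtains u v where "w = vstack u v"
proof
  show "w = vstack (\<chi> i. w $ Inl i) (\<chi> j. w $ Inr j)"
    by (simp add: vec_eq_iff split_sum_all)
qed

lemma vlower_vstack [simp]: "vlower (vstack u v) = v"
  by (simp add: vlower_def vec_eq_iff)

lemma vstack_eq_0_iff [simp]:
  fixes u :: "'a::zero ^ 'm" and v :: "'a ^ 'n"
  shows "vstack u v = 0 \<longleftrightarrow> u = 0 \<and> v = 0"
  by (simp add: vec_eq_iff split_sum_all)

lemma vstack_add:
  fixes u u' :: "'a::plus ^ 'm" and v v' :: "'a ^ 'n"
  shows "vstack u v + vstack u' v' = vstack (u + u') (v + v')"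
  by (simp add: vec_eq_iff split_sum_all)

lemma minus_matrix_mult_vector:
  fixes A :: "'a::ring_1 ^ 'n ^ 'm"
  shows "(- A) *v x = - (A *v x)"
  by (simp add: vec_eq_iff matrix_vector_mult_def sum_negf)

lemma transpose_zero [simp]: "transpose 0 = (0 :: 'a::zero ^ 'n ^ 'm)"
  by (simp add: vec_eq_iff transpose_def)

lemma transpose_minus: "transpose (- A) = - transpose (A :: 'a::uminus ^ 'n ^ 'm)"
  by (simp add: vec_eq_iff transpose_def)

lemma sum_UNIV_Plus:
  fixes f :: "'m::finite + 'n::finite \<Rightarrow> 'a::comm_monoid_add"
  shows "sum f UNIV = (\<Sum>i\<in>UNIV. f (Inl i)) + (\<Sum>j\<in>UNIV. f (Inr j))"
  unfolding UNIV_Plus_UNIV[symmetric] by (subst sum.Plus) auto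

lemma vstack_mult_vector:
  "vstack A B *v x = vstack (A *v x) (B *v x)"
  by (simp add: vec_eq_iff split_sum_all matrix_vector_mult_def)

lemma hstack_mult_vstack:
  "hstack A B *v vstack x y = A *v x + B *v y"
  by (simp add: vec_eq_iff hstack_def matrix_vector_mult_def sum_UNIV_Plus)

lemma transpose_vstack_mult_vstack:
  "transpose (vstack A B) *v vstack x y = transpose A *v x + transpose B *v y"
  by (simp add: vec_eq_iff transpose_def matrix_vector_mult_def sum_UNIV_Plus)

lemma transpose_hstack_mult_vector:
  "transpose (hstack A B) *v x = vstack (transpose A *v x) (transpose B *v x)"
  by (simp add: vec_eq_iff split_sum_all hstack_def transpose_def matrix_vector_mult_def)

text \<open>The Gram matrix has the same kernel as \<open>A\<close>, and a square matrix with
  trivial kernel is invertible. Kernels are easy to follow through block matrices.\<close>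

lemma invertible_gram_iff:
  fixes A :: "real ^ 'p ^ 'n"
  shows "invertible (transpose A ** A) \<longleftrightarrow> (\<forall>x. A *v x = 0 \<longrightarrow> x = 0)"
proof -
  have "(transpose A ** A) *v x = 0 \<longleftrightarrow> A *v x = 0" for x
  proof
    assume "(transpose A ** A) *v x = 0"
    then have "x \<bullet> (transpose A *v (A *v x)) = 0"
      by (simp add: matrix_vector_mul_assoc)
    \<comment> \<open>Moving \<open>transpose A\<close> across the inner product turns it into the
      squared norm of \<open>A *v x\<close>.\<close>
    then have "(A *v x) \<bullet> (A *v x) = 0"
      by (simp add: dot_lmul_matrix[symmetric])
    then show "A *v x = 0" by simp
  qed (simp flip: matrix_vector_mul_assoc)
  then show ?thesis
    by (simp add: invertible_left_inverse matrix_left_invertible_ker)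
qed

lemma matrix_inv_mult:
  assumes "invertible A"
  shows "matrix_inv A ** A = mat 1" and "A ** matrix_inv A = mat 1"
  using assms unfolding invertible_def matrix_inv_def by (metis (mono_tags, lifting) someI_ex)+

text \<open>One direction multiplies by the Gram matrix, the other by its inverse. A guessed
  coefficient vector can thus be verified without inverting a block matrix.\<close>

lemma ols_eq_iff_normal_equations:
  assumes "invertible (transpose A ** A)"
  shows "ols A y = w \<longleftrightarrow> transpose A *v (A *v w) = transpose A *v y"
proof
  assume "ols A y = w"
  then show "transpose A *v (A *v w) = transpose A *v y"
    using assms
    by (auto simp: ols_def matrix_vector_mul_assoc matrix_mul_assoc matrix_inv_mult)
next
  assume "transpose A *v (A *v w) = transpose A *v y"
  then have "matrix_inv (transpose A ** A) *v ((transpose A ** A) *v w) = ols A y"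
    by (simp add: ols_def flip: matrix_vector_mul_assoc)
  then show "ols A y = w"
    using assms by (simp add: matrix_vector_mul_assoc matrix_inv_mult)
qed

lemma ols_normal_equations:
  assumes "invertible (transpose A ** A)"
  shows "transpose A *v (A *v ols A y) = transpose A *v y"
  using ols_eq_iff_normal_equations[OF assms] by blast

lemma augmented_design_mult_vstack:
  "augmented_design Xo Xm *v vstack u v = vstack (Xo *v u) (Xm *v u - v)"
  by (simp add: augmented_design_def vstack_mult_vector hstack_mult_vstack
      minus_matrix_mult_vector)

text \<open>The lower block \<open>- y\<close> comes from the added covariates: their normal
  equations force the residuals of the missing rows to vanish.\<close>

lemma transpose_augmented_design_mult_vstack:
  "transpose (augmented_design Xo Xm) *v vstack x y =
    vstack (transpose Xo *v x + transpose Xm *v y) (- y)"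
  by (simp add: augmented_design_def transpose_vstack_mult_vstack transpose_hstack_mult_vector
      vstack_add transpose_minus minus_matrix_mult_vector)

text \<open>The upper rows give \<open>Xo *v u = 0\<close>, hence \<open>u = 0\<close>; the lower
  rows then reduce to \<open>v = 0\<close>.\<close>

lemma invertible_gram_augmented_design:
  assumes "invertible (transpose Xo ** Xo)"
  shows "invertible (transpose (augmented_design Xo Xm) ** augmented_design Xo Xm)"
  unfolding invertible_gram_iff
proof (intro allI impI)
  fix w assume w: "augmented_design Xo Xm *v w = 0"
  obtain u v where "w = vstack u v" by (rule vstack_cases)
  with w assms show "w = 0"
    by (auto simp: augmented_design_mult_vstack invertible_gram_iff)
qed

text \<open>A vector killed by the stacked matrix is already killed by its upper block
  \<open>A\<close>.\<close>

lemma invertible_gram_vstack: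
  fixes A :: "real ^ 'p ^ 'm"
  assumes "invertible (transpose A ** A)"
  shows "invertible (transpose (vstack A B) ** vstack A B)"
  using assms by (simp add: invertible_gram_iff vstack_mult_vector)

lemma ols_augmented_design:
  assumes inv: "invertible (transpose Xo ** Xo)"
  shows "ols (augmented_design Xo Xm) (vstack Yo 0) = vstack (ols Xo Yo) (Xm *v ols Xo Yo)"
  by (simp add: ols_eq_iff_normal_equations[OF invertible_gram_augmented_design[OF inv]]
      augmented_design_mult_vstack transpose_augmented_design_mult_vstack
      ols_normal_equations[OF inv])

lemma em_fixed_point_eq_ols:
  assumes inv: "invertible (transpose Xo ** Xo)"
    and fixed: "b = ols (vstack Xo Xm) (vstack Yo (Xm *v b))"
  shows "b = ols Xo Yo"
proof -
  \<comment> \<open>These are the normal equations of the completed data, split by rows; the imputed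
    responses coincide with their fitted values, so the \<open>Xm\<close> terms agree.\<close>
  have "transpose Xo *v (Xo *v b) + transpose Xm *v (Xm *v b) =
      transpose Xo *v Yo + transpose Xm *v (Xm *v b)"
    using fixed[symmetric] unfolding ols_eq_iff_normal_equations[OF invertible_gram_vstack[OF inv]]
    by (simp add: vstack_mult_vector transpose_vstack_mult_vstack)
  then show ?thesis
    using ols_eq_iff_normal_equations[OF inv] by (metis add_right_cancel)
qed

theorem theorem4:
  fixes Xo :: "real ^ 'p ^ 'no" and Xm :: "real ^ 'p ^ 'nm" and Yo :: "real ^ 'no"
    and Z :: "real ^ ('p + 'nm) ^ ('no + 'nm)" and X :: "real ^ 'p ^ ('no + 'nm)"
    and bm :: "real ^ 'nm"
  assumes "invertible (transpose Xo ** Xo)"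
    and "X = vstack Xo Xm"
    and "Z = augmented_design Xo Xm"
    and "bm = vlower (ols Z (vstack Yo 0))"
  shows "invertible (transpose Z ** Z) \<and> invertible (transpose X ** X) \<and>
    bm = (Xm ** matrix_inv (transpose Xo ** Xo) ** transpose Xo) *v Yo \<and>
    (\<forall>b0 b. em_converges_to Xo Xm Yo b0 b \<longrightarrow> bm = Xm *v b)"
proof -
  have bm: "bm = Xm *v ols Xo Yo"
    by (simp add: assms ols_augmented_design)
  \<comment> \<open>Continuity of the EM step makes any limit a fixed point, whatever the start
    \<open>b0\<close>, and the only fixed point is \<open>ols Xo Yo\<close>.\<close>
  moreover have "bm = Xm *v b" if "em_converges_to Xo Xm Yo b0 b" for b0 b
    using bm em_fixed_point_eq_ols[OF assms(1)] em_limit_iff_fixed_point that by metis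
  ultimately show ?thesis
    using assms
    by (auto simp: invertible_gram_augmented_design invertible_gram_vstack ols_def
        matrix_vector_mul_assoc matrix_mul_assoc)
qed

end
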